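(* Let $\tilde{\mathbf f}:I\to\mathbf{R}_F$ be the fuzzy valued recurrent fractal interpolation function interpolating $\mathbf P=\{(x_i,u_i):i=0,\dots,n\}$ described in the context, and suppose that $d_\infty(\tilde{\mathbf f}(x),\tilde{\mathbf f}(y))\le H_{\tilde{\mathbf f}}|x-y|^\tau$ for all $x,y\in I$, where $H_{\tilde{\mathbf f}}\ge0$ is its Hölder coefficient and $\tau\in(0,1]$ its Hölder exponent. Let $\mathbf P^*=\{(x_i^*,u_i^* ):i=0,\dots,n\}$ with $x_0=x_0^*<x_1^*<\cdots<x_n^*=x_n$ and $u_i^*\in\mathbf{R}_F$, put $I_i^*=[x_{i-1}^*,x_i^*]$, let $R:I\to I$ be given by $R(x)=x_{i-1}^*+\frac{x_i^*-x_{i-1}^*}{x_i-x_{i-1}}(x-x_{i-1})$ for $x\in I_i$, and put $\tilde l_i^*=R\circ\tilde l_i\circ R^{-1}:[x_{s_i}^*,x_{e_i}^*]\to I_i^*$. Let $\tilde{\mathbf q}_i^*:I_i^*\to\mathbf{R}_F$, $i=1,\dots,n$, be Lipschitz mappings satisfying $$\alpha_iu_{s_i}^*\oplus\tilde{\mathbf q}_i^*(\tilde l_i^*(x_{s_i}^* ))=u_{i-1}^*,\qquad \alpha_iu_{e_i}^*\oplus\tilde{\mathbf q}_i^*(\tilde l_i^*(x_{e_i}^* ))=u_i^*,$$ and, for a constant $\mu\geq 0$, $$D(\tilde{\mathbf q}_i\circ R^{-1},\tilde{\mathbf q}_i^* )=\sup_{x\in I_i^*}d_\infty(\tilde{\mathbf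 q}_i(R^{-1}(x)),\tilde{\mathbf q}_i^*(x))\le\mu\max_{k=0,\dots,n}d_\infty(u_k,u_k^* )\quad (i=1,\dots,n).$$ Let $\tilde{\mathbf f}^*:I\to\mathbf{R}_F$ be the fuzzy valued recurrent fractal interpolation function interpolating $\mathbf P^*$, i.e. the continuous function with $\tilde{\mathbf f}^*(x_i^* )=u_i^*$ ($i=0,\dots,n$) and $\tilde{\mathbf f}^*(x)=\alpha_i\tilde{\mathbf f}^*(\tilde l_i^{*-1}(x))\oplus\tilde{\mathbf q}_i^*(x)$ for $x\in I_i^*$, $i=1,\dots,n$. Then, with $\alpha=\max_{i=1,\dots,n}\alpha_i$, $$D(\tilde{\mathbf f},\tilde{\mathbf f}^* )\le\frac{(1+\alpha)H_{\tilde{\mathbf f}}\max_{i=0,\dots,n}|x_i-x_i^*|^\tau+\mu\max_{i=0,\dots,n}d_\infty(u_i,u_i^* )}{1-\alpha}.$$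
   Context: $\mathbf{R}_F$ is the space of fuzzy numbers over $\mathbf{R}$ (normal, fuzzy convex, upper semicontinuous functions $u:\mathbf{R}\to[0,1]$ with compact support). For $u\in\mathbf{R}_F$ and $0\le\lambda\le1$ the $\lambda$-level set is the compact interval $[u]^\lambda=[u^-(\lambda),u^+(\lambda)]$ (for $\lambda=0$, the closure of the support). Addition $\oplus$ and multiplication by a real scalar $\alpha\ge0$ are levelwise: $(u\oplus v)^\pm(\lambda)=u^\pm(\lambda)+v^\pm(\lambda)$, $(\alpha u)^\pm(\lambda)=\alpha u^\pm(\lambda)$. The metric on $\mathbf{R}_F$ is $d_\infty(u,v)=\sup_{\lambda\in[0,1]}\max\{|u^-(\lambda)-v^-(\lambda)|,|u^+(\lambda)-v^+(\lambda)|\}$; $(\mathbf{R}_F,d_\infty)$ is complete. For continuous fuzzy valued functions $f,g$ on a compact set $K\subset\mathbf{R}$, $D(f,g)=\sup_{x\in K}d_\infty(f(x),g(x))$. Data: $n\ge2$, real numbers $x_0<\cdots<x_n$, fuzzy numbers $u_0,\dots,u_n\in\mathbf{R}_F$, $I=[x_0,x_n]$, $I_i=[x_{i-1},x_i]$ ($i=1,\dots,n$). For each $i\in\{1,\dots,n\}$: integers $0\le s_i<e_i\le n$ with $e_i-s_i\ge2$; $\tilde I_{\sigma(i)}=[x_{s_i},x_{e_i}]$; the affine map $\tilde l_i:\tilde I_{\sigma(i)}\to I_i$, $\tilde l_i(x)=\frac{x_i-x_{i-1}}{x_{e_i}-x_{s_i}}(x-x_{s_i})+x_{i-1}$, with $\frac{x_i-x_{i-1}}{x_{e_i}-x_{s_i}}<1$;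 a vertical scaling factor $0\le\alpha_i<1$; a Lipschitz mapping $\tilde{\mathbf q}_i:I_i\to\mathbf{R}_F$ with $\alpha_iu_{s_i}\oplus\tilde{\mathbf q}_i(x_{i-1})=u_{i-1}$ and $\alpha_iu_{e_i}\oplus\tilde{\mathbf q}_i(x_i)=u_i$. The $n\times n$ matrix $M=(p_{st})$, $p_{st}=1/a_s$ if $I_s\subseteq\tilde I_{\sigma(t)}$ and $0$ otherwise, with $a_s$ the number of $i$ such that $I_s\subseteq\tilde I_{\sigma(i)}$, is assumed irreducible. The fuzzy valued recurrent fractal interpolation function (RFIF) $\tilde{\mathbf f}$ is the unique continuous function $I\to\mathbf{R}_F$ with $\tilde{\mathbf f}(x_i)=u_i$ for $i=0,\dots,n$ and $\tilde{\mathbf f}(x)=\alpha_i\tilde{\mathbf f}(\tilde l_i^{-1}(x))\oplus\tilde{\mathbf q}_i(x)$ for all $x\in I_i$, $i=1,\dots,n$ (its graph is the attractor of the recurrent iterated function system with maps $(x,u)\mapsto(\tilde l_i(x),\alpha_iu\oplus\tilde{\mathbf q}_i(\tilde l_i(x)))$ on $\tilde I_{\sigma(i)}\times\mathbf{R}_F$). *)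

theory Defs
  imports "HOL-Analysis.Analysis"
begin

section \<open>Fuzzy numbers\<close>

definition is_fuzzy_number :: "(real \<Rightarrow> real) \<Rightarrow> bool" where
  "is_fuzzy_number u \<longleftrightarrow>
     (\<forall>x. 0 \<le> u x \<and> u x \<le> 1) \<and>
     (\<exists>x. u x = 1) \<and>
     (\<forall>x y. \<forall>t\<in>{0..1}. min (u x) (u y) \<le> u (t * x + (1 - t) * y)) \<and>
     (\<forall>a. open {x. u x < a}) \<and>
     compact (closure {x. u x > 0})"

lemma is_fuzzy_number_indicator_0: "is_fuzzy_number (indicator {0})"
proof -
  have "open {x. indicator {0::real} x < (a::real)}" for a
  proof -
    have "{x. indicator {0} x < a} = (if a \<le> 0 then {} else if a \<le> 1 then - {0} else (UNIV::real set))"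
      by (auto simp: indicator_def)
    then show ?thesis by (simp add: open_Compl)
  qed
  moreover have "{x. indicator {0} x > (0::real)} = {0::real}"
    by (auto simp: indicator_def)
  moreover have "compact (closure {x. indicator {0} x > (0::real)} :: real set)"
    using calculation(2) by simp
  moreover have "\<exists>x. indicator {0::real} x = (1::real)" by (rule exI[of _ 0]) simp
  moreover have "min (indicator {0} y) (indicator {0} z) \<le> (indicator {0} (t * y + (1 - t) * z) :: real)"
    for y z t :: real by (simp add: indicator_def)
  ultimately show ?thesis
    unfolding is_fuzzy_number_def using indicator_abs_le_1[of "{0::real}", where 'a=real] by simp
qed

typedef fuzzy = "{u. is_fuzzy_number u}" morphisms membership Abs_fuzzy
  using is_fuzzy_number_indicator_0 by blast

definition level :: "fuzzy \<Rightarrow> real \<Rightarrow> real set" where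
  "level u \<gamma> = (if \<gamma> = 0 then closure {x. membership u x > 0} else {x. membership u x \<ge> \<gamma>})"

definition lower :: "fuzzy \<Rightarrow> real \<Rightarrow> real" where
  "lower u \<gamma> = Inf (level u \<gamma>)"

definition upper :: "fuzzy \<Rightarrow> real \<Rightarrow> real" where
  "upper u \<gamma> = Sup (level u \<gamma>)"

lemma membership_fuzzy: "is_fuzzy_number (membership u)"
  using membership by blast

lemma level_0_compact: "compact (level u 0)"
  using membership_fuzzy[of u] by (simp add: level_def is_fuzzy_number_def)

lemma level_antimono: "0 \<le> \<gamma> \<Longrightarrow> \<gamma> \<le> \<mu> \<Longrightarrow> level u \<mu> \<subseteq> level u \<gamma>"
proof -
  assume a: "0 \<le> \<gamma>" "\<gamma> \<le> \<mu>"
  have "{x. membership u x \<ge> \<mu>} \<subseteq> {x. membership u x > 0}" if "\<mu> > 0"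
    using that by auto
  then show ?thesis
    using a closure_subset[of "{x. membership u x > 0}"] unfolding level_def
    by (cases "\<gamma> = 0"; cases "\<mu> = 0") auto
qed

lemma level_nonempty: "0 \<le> \<gamma> \<Longrightarrow> \<gamma> \<le> 1 \<Longrightarrow> level u \<gamma> \<noteq> {}"
proof -
  assume a: "0 \<le> \<gamma>" "\<gamma> \<le> 1"
  obtain x where "membership u x = 1"
    using membership_fuzzy[of u] unfolding is_fuzzy_number_def by blast
  then have "x \<in> level u 1" by (simp add: level_def)
  then show ?thesis using level_antimono[OF a, of u] by blast
qed

lemma level_compact: "0 \<le> \<gamma> \<Longrightarrow> compact (level u \<gamma>)"
proof (cases "\<gamma> = 0")
  case False
  assume a: "0 \<le> \<gamma>"
  have "level u \<gamma> = - {x. membership u x < \<gamma>}"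
    using False by (auto simp: level_def)
  moreover have "open {x. membership u x < \<gamma>}"
    using membership_fuzzy[of u] unfolding is_fuzzy_number_def by blast
  ultimately have "closed (level u \<gamma>)" by (simp add: closed_def)
  then show ?thesis
    using level_antimono[of 0 \<gamma> u] a level_0_compact[of u]
    by (metis compact_Int_closed inf.absorb_iff2 order_refl)
qed (use level_0_compact in simp)

lemma level_convex: "0 \<le> \<gamma> \<Longrightarrow> convex (level u \<gamma>)"
proof -
  assume "0 \<le> \<gamma>"
  have *: "min (membership u x) (membership u y) \<le> membership u (s * x + t * y)"
    if "0 \<le> s" "0 \<le> t" "s + t = 1" for x y s t
  proof -
    have "t = 1 - s" "s \<in> {0..1}" using that by auto
    then show ?thesis
      using membership_fuzzy[of u] unfolding is_fuzzy_number_def by blast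
  qed
  have "convex {x. membership u x > 0}"
    unfolding convex_def
  proof (intro ballI allI impI)
    fix x y s t :: real
    assume "x \<in> {x. 0 < membership u x}" "y \<in> {x. 0 < membership u x}" "0 \<le> s" "0 \<le> t" "s + t = 1"
    then show "s *\<^sub>R x + t *\<^sub>R y \<in> {x. 0 < membership u x}"
      using *[of s t x y] by simp
  qed
  moreover have "convex {x. membership u x \<ge> \<gamma>}"
    unfolding convex_def
  proof (intro ballI allI impI)
    fix x y s t :: real
    assume "x \<in> {x. \<gamma> \<le> membership u x}" "y \<in> {x. \<gamma> \<le> membership u x}" "0 \<le> s" "0 \<le> t" "s + t = 1"
    then show "s *\<^sub>R x + t *\<^sub>R y \<in> {x. \<gamma> \<le> membership u x}"
      using *[of s t x y] by simp
  qed
  ultimately show ?thesis by (simp add: level_def convex_closure)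
qed

lemma level_eq:
  assumes "0 \<le> \<gamma>" "\<gamma> \<le> 1"
  shows "level u \<gamma> = {lower u \<gamma>..upper u \<gamma>}" and "lower u \<gamma> \<le> upper u \<gamma>"
proof -
  have "connected (level u \<gamma>)" using level_convex assms convex_connected by blast
  then obtain a b where ab: "level u \<gamma> = {a..b}"
    using level_compact[OF assms(1), of u] connected_compact_interval_1 by blast
  moreover have "a \<le> b" using level_nonempty[OF assms, of u] ab by auto
  ultimately show "level u \<gamma> = {lower u \<gamma>..upper u \<gamma>}" "lower u \<gamma> \<le> upper u \<gamma>"
    by (simp_all add: lower_def upper_def)
qed

lemma lower_mono: "0 \<le> \<gamma> \<Longrightarrow> \<gamma> \<le> \<mu> \<Longrightarrow> \<mu> \<le> 1 \<Longrightarrow> lower u \<gamma> \<le> lower u \<mu>"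
  using level_antimono[of \<gamma> \<mu> u] level_eq[of \<gamma> u] level_eq[of \<mu> u] by auto

lemma upper_antimono: "0 \<le> \<gamma> \<Longrightarrow> \<gamma> \<le> \<mu> \<Longrightarrow> \<mu> \<le> 1 \<Longrightarrow> upper u \<mu> \<le> upper u \<gamma>"
  using level_antimono[of \<gamma> \<mu> u] level_eq[of \<gamma> u] level_eq[of \<mu> u] by auto

lemma membership_ge_iff:
  "0 < \<gamma> \<Longrightarrow> \<gamma> \<le> 1 \<Longrightarrow> membership u x \<ge> \<gamma> \<longleftrightarrow> lower u \<gamma> \<le> x \<and> x \<le> upper u \<gamma>"
proof -
  assume a: "0 < \<gamma>" "\<gamma> \<le> 1"
  have "membership u x \<ge> \<gamma> \<longleftrightarrow> x \<in> level u \<gamma>" using a by (simp add: level_def)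
  also have "\<dots> \<longleftrightarrow> x \<in> {lower u \<gamma>..upper u \<gamma>}" using level_eq(1)[of \<gamma> u] a by simp
  finally show ?thesis by simp
qed

lemma membership_less_ev:
  assumes "0 < \<gamma>" "membership u x < \<gamma>"
  shows "\<forall>\<^sub>F \<mu> in at_left \<gamma>. 0 < \<mu> \<and> \<mu> < \<gamma> \<and> membership u x < \<mu>"
proof -
  have "0 \<le> membership u x" using membership_fuzzy[of u] by (simp add: is_fuzzy_number_def)
  then show ?thesis
    using assms eventually_at_left_real[OF assms(2)] by (auto elim!: eventually_mono)
qed

lemma lower_tendsto_left:
  assumes "0 < \<gamma>" "\<gamma> \<le> 1" shows "(lower u \<longlongrightarrow> lower u \<gamma>) (at_left \<gamma>)"
proof (rule order_tendstoI)
  fix y assume "y < lower u \<gamma>"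
  then have "membership u y < \<gamma>" using membership_ge_iff[OF assms, of u y] by auto
  from membership_less_ev[OF assms(1) this]
  show "\<forall>\<^sub>F \<mu> in at_left \<gamma>. y < lower u \<mu>"
  proof (rule eventually_mono)
    fix \<mu> assume m: "0 < \<mu> \<and> \<mu> < \<gamma> \<and> membership u y < \<mu>"
    then show "y < lower u \<mu>"
      using membership_ge_iff[of \<mu> u y] upper_antimono[of \<mu> \<gamma> u] level_eq(2)[of \<gamma> u] assms
        \<open>y < lower u \<gamma>\<close> by auto
  qed
next
  fix y assume "lower u \<gamma> < y"
  show "\<forall>\<^sub>F \<mu> in at_left \<gamma>. lower u \<mu> < y"
  proof (rule eventually_mono[OF eventually_at_left_real[OF assms(1)]])
    fix \<mu> assume "\<mu> \<in> {0<..<\<gamma>}"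
    then show "lower u \<mu> < y" using lower_mono[of \<mu> \<gamma> u] assms(2) \<open>lower u \<gamma> < y\<close> by simp
  qed
qed

lemma upper_tendsto_left:
  assumes "0 < \<gamma>" "\<gamma> \<le> 1" shows "(upper u \<longlongrightarrow> upper u \<gamma>) (at_left \<gamma>)"
proof (rule order_tendstoI)
  fix y assume "upper u \<gamma> < y"
  then have "membership u y < \<gamma>" using membership_ge_iff[OF assms, of u y] by auto
  from membership_less_ev[OF assms(1) this]
  show "\<forall>\<^sub>F \<mu> in at_left \<gamma>. upper u \<mu> < y"
  proof (rule eventually_mono)
    fix \<mu> assume m: "0 < \<mu> \<and> \<mu> < \<gamma> \<and> membership u y < \<mu>"
    then show "upper u \<mu> < y"
      using membership_ge_iff[of \<mu> u y] lower_mono[of \<mu> \<gamma> u] level_eq(2)[of \<gamma> u] assms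
        \<open>upper u \<gamma> < y\<close> by auto
  qed
next
  fix y assume "y < upper u \<gamma>"
  show "\<forall>\<^sub>F \<mu> in at_left \<gamma>. y < upper u \<mu>"
  proof (rule eventually_mono[OF eventually_at_left_real[OF assms(1)]])
    fix \<mu> assume "\<mu> \<in> {0<..<\<gamma>}"
    then show "y < upper u \<mu>" using upper_antimono[of \<mu> \<gamma> u] assms(2) \<open>y < upper u \<gamma>\<close> by simp
  qed
qed

lemma lower_tendsto_0: "(lower u \<longlongrightarrow> lower u 0) (at_right 0)"
proof (rule order_tendstoI)
  fix y assume "y < lower u 0"
  show "\<forall>\<^sub>F \<mu> in at_right 0. y < lower u \<mu>"
  proof (rule eventually_mono[OF eventually_at_right_real[OF zero_less_one]])
    fix \<mu> :: real assume "\<mu> \<in> {0<..<1}"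
    then show "y < lower u \<mu>" using lower_mono[of 0 \<mu> u] \<open>y < lower u 0\<close> by simp
  qed
next
  fix y assume y: "lower u 0 < y"
  have "lower u 0 \<in> closure {x. membership u x > 0}"
    using level_eq[of 0 u] by (auto simp: level_def)
  then obtain z where z: "membership u z > 0" "dist z (lower u 0) < y - lower u 0"
    using y unfolding closure_approachable by (auto dest: spec[of _ "y - lower u 0"])
  have "membership u z \<le> 1" using membership_fuzzy[of u] by (simp add: is_fuzzy_number_def)
  note z1 = this
  show "\<forall>\<^sub>F \<mu> in at_right 0. lower u \<mu> < y"
  proof (rule eventually_mono[OF eventually_at_right_real[OF z(1)]])
    fix \<mu> :: real assume "\<mu> \<in> {0<..<membership u z}"
    then show "lower u \<mu> < y"
      using z(2) z1 membership_ge_iff[of \<mu> u z] by (auto simp: dist_real_def)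
  qed
qed

lemma upper_tendsto_0: "(upper u \<longlongrightarrow> upper u 0) (at_right 0)"
proof (rule order_tendstoI)
  fix y assume "upper u 0 < y"
  show "\<forall>\<^sub>F \<mu> in at_right 0. upper u \<mu> < y"
  proof (rule eventually_mono[OF eventually_at_right_real[OF zero_less_one]])
    fix \<mu> :: real assume "\<mu> \<in> {0<..<1}"
    then show "upper u \<mu> < y" using upper_antimono[of 0 \<mu> u] \<open>upper u 0 < y\<close> by simp
  qed
next
  fix y assume y: "y < upper u 0"
  have "upper u 0 \<in> closure {x. membership u x > 0}"
    using level_eq[of 0 u] by (auto simp: level_def)
  then obtain z where z: "membership u z > 0" "dist z (upper u 0) < upper u 0 - y"
    using y unfolding closure_approachable by (auto dest: spec[of _ "upper u 0 - y"])
  have "membership u z \<le> 1" using membership_fuzzy[of u] by (simp add: is_fuzzy_number_def)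
  note z1 = this
  show "\<forall>\<^sub>F \<mu> in at_right 0. y < upper u \<mu>"
  proof (rule eventually_mono[OF eventually_at_right_real[OF z(1)]])
    fix \<mu> :: real assume "\<mu> \<in> {0<..<membership u z}"
    then show "y < upper u \<mu>"
      using z(2) z1 membership_ge_iff[of \<mu> u z] by (auto simp: dist_real_def)
  qed
qed

lemma fuzzy_eqI:
  assumes "\<And>\<gamma>. 0 \<le> \<gamma> \<Longrightarrow> \<gamma> \<le> 1 \<Longrightarrow> lower u \<gamma> = lower v \<gamma>"
      and "\<And>\<gamma>. 0 \<le> \<gamma> \<Longrightarrow> \<gamma> \<le> 1 \<Longrightarrow> upper u \<gamma> = upper v \<gamma>"
  shows "u = v"
proof -
  have b: "0 \<le> membership w x" "membership w x \<le> 1" for w x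
    using membership_fuzzy[of w] by (simp_all add: is_fuzzy_number_def)
  have *: "\<gamma> \<le> membership u x \<longleftrightarrow> \<gamma> \<le> membership v x" if "0 < \<gamma>" "\<gamma> \<le> 1" for \<gamma> x
    using assms that by (simp add: membership_ge_iff)
  have "membership u x = membership v x" for x
    using *[of "membership u x" x] *[of "membership v x" x] b[of u x] b[of v x]
    by (smt (verit))
  then show ?thesis by (metis membership_inject ext)
qed

text \<open>The Goetschel--Voxman representation: endpoint functions with the properties
  established above determine a fuzzy number.\<close>

lemma fuzzy_exists:
  fixes a b :: "real \<Rightarrow> real"
  assumes mono: "\<And>\<gamma> \<mu>. 0 \<le> \<gamma> \<Longrightarrow> \<gamma> \<le> \<mu> \<Longrightarrow> \<mu> \<le> 1 \<Longrightarrow> a \<gamma> \<le> a \<mu> \<and> b \<mu> \<le> b \<gamma>"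
    and le: "a 1 \<le> b 1"
    and al: "\<And>\<gamma>. 0 < \<gamma> \<Longrightarrow> \<gamma> \<le> 1 \<Longrightarrow> (a \<longlongrightarrow> a \<gamma>) (at_left \<gamma>)"
    and bl: "\<And>\<gamma>. 0 < \<gamma> \<Longrightarrow> \<gamma> \<le> 1 \<Longrightarrow> (b \<longlongrightarrow> b \<gamma>) (at_left \<gamma>)"
    and ar: "(a \<longlongrightarrow> a 0) (at_right 0)" and br: "(b \<longlongrightarrow> b 0) (at_right 0)"
  shows "\<exists>!w. \<forall>\<gamma>\<in>{0..1}. lower w \<gamma> = a \<gamma> \<and> upper w \<gamma> = b \<gamma>"
proof (rule ex_ex1I)
  define S where "S x = insert 0 {\<gamma>. 0 < \<gamma> \<and> \<gamma> \<le> 1 \<and> a \<gamma> \<le> x \<and> x \<le> b \<gamma>}" for x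
  define w where "w x = Sup (S x)" for x
  have bdd: "bdd_above (S x)" for x by (rule bdd_aboveI[of _ 1]) (auto simp: S_def)
  have w0: "0 \<le> w x" for x unfolding w_def by (rule cSup_upper[OF _ bdd]) (simp add: S_def)
  have w1: "w x \<le> 1" for x unfolding w_def by (rule cSup_least) (auto simp: S_def)
  have ab: "a \<gamma> \<le> b \<gamma>" if "0 \<le> \<gamma>" "\<gamma> \<le> 1" for \<gamma>
    using mono[of \<gamma> 1] that le by auto
  have ge: "\<gamma> \<le> w x \<longleftrightarrow> a \<gamma> \<le> x \<and> x \<le> b \<gamma>" if l: "0 < \<gamma>" "\<gamma> \<le> 1" for \<gamma> x
  proof
    assume "a \<gamma> \<le> x \<and> x \<le> b \<gamma>"
    then show "\<gamma> \<le> w x" unfolding w_def using l by (intro cSup_upper[OF _ bdd]) (simp add: S_def)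
  next
    assume lw: "\<gamma> \<le> w x"
    have "a \<mu> \<le> x \<and> x \<le> b \<mu>" if m: "0 < \<mu>" "\<mu> < \<gamma>" for \<mu>
    proof -
      have "\<mu> < Sup (S x)" using lw m by (simp add: w_def)
      moreover have "S x \<noteq> {}" by (simp add: S_def)
      ultimately obtain \<nu> where "\<nu> \<in> S x" "\<mu> < \<nu>" using less_cSupD by blast
      then show ?thesis using mono[of \<mu> \<nu>] m by (auto simp: S_def)
    qed
    then have "\<forall>\<^sub>F \<mu> in at_left \<gamma>. a \<mu> \<le> x" "\<forall>\<^sub>F \<mu> in at_left \<gamma>. x \<le> b \<mu>"
      using eventually_at_left_real[OF l(1)] by (auto elim!: eventually_mono)
    then show "a \<gamma> \<le> x \<and> x \<le> b \<gamma>"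
      using tendsto_upperbound[OF al[OF l]] tendsto_lowerbound[OF bl[OF l]] by simp
  qed
  have sub: "{x. w x > 0} \<subseteq> {a 0..b 0}"
  proof
    fix x assume "x \<in> {x. w x > 0}"
    then show "x \<in> {a 0..b 0}" using ge[of "w x" x] w1[of x] mono[of 0 "w x"] by auto
  qed
  have inc: "{a \<gamma>..b \<gamma>} \<subseteq> {x. w x > 0}" if "0 < \<gamma>" "\<gamma> \<le> 1" for \<gamma>
  proof
    fix x assume "x \<in> {a \<gamma>..b \<gamma>}"
    then show "x \<in> {x. w x > 0}" using ge[OF that, of x] that by simp
  qed
  have ev: "\<forall>\<^sub>F \<gamma> in at_right (0::real). 0 < \<gamma> \<and> \<gamma> \<le> 1"
    using eventually_at_right_real[of 0 "1::real"] by (auto elim!: eventually_mono)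
  have "a 0 \<in> closure {x. w x > 0}"
  proof (rule Lim_in_closed_set[OF _ _ _ ar])
    show "\<forall>\<^sub>F \<gamma> in at_right 0. a \<gamma> \<in> closure {x. w x > 0}"
      using ev
    proof (rule eventually_mono)
      fix \<gamma> :: real assume g: "0 < \<gamma> \<and> \<gamma> \<le> 1"
      then have "a \<gamma> \<in> {a \<gamma>..b \<gamma>}" using ab[of \<gamma>] by simp
      then show "a \<gamma> \<in> closure {x. w x > 0}" using g inc[of \<gamma>] closure_subset by blast
    qed
  qed auto
  moreover have "b 0 \<in> closure {x. w x > 0}"
  proof (rule Lim_in_closed_set[OF _ _ _ br])
    show "\<forall>\<^sub>F \<gamma> in at_right 0. b \<gamma> \<in> closure {x. w x > 0}"
      using ev
    proof (rule eventually_mono)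
      fix \<gamma> :: real assume g: "0 < \<gamma> \<and> \<gamma> \<le> 1"
      then have "b \<gamma> \<in> {a \<gamma>..b \<gamma>}" using ab[of \<gamma>] by simp
      then show "b \<gamma> \<in> closure {x. w x > 0}" using g inc[of \<gamma>] closure_subset by blast
    qed
  qed auto
  moreover have conv: "min (w x) (w y) \<le> w (t * x + (1 - t) * y)" if "t \<in> {0..1}" for x y t
  proof (cases "min (w x) (w y) = 0")
    case True then show ?thesis by (simp add: w0)
  next
    case False
    define m where "m = min (w x) (w y)"
    have m: "0 < m" "m \<le> 1" "m \<le> w x" "m \<le> w y"
      using False w0[of x] w0[of y] w1[of x] by (auto simp: m_def)
    have "x \<in> {a m..b m}" "y \<in> {a m..b m}" using ge[OF m(1,2)] m(3,4) by simp_all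
    then have "t *\<^sub>R x + (1 - t) *\<^sub>R y \<in> {a m..b m}"
      using that by (intro convexD[OF convex_real_interval(5)]) auto
    then show ?thesis using ge[OF m(1,2)] by (simp add: m_def)
  qed
  moreover have "convex (closure {x. w x > 0})"
  proof (rule convex_closure, unfold convex_def, intro ballI allI impI)
    fix x y s t :: real
    assume "x \<in> {x. 0 < w x}" "y \<in> {x. 0 < w x}" "0 \<le> s" "0 \<le> t" "s + t = 1"
    moreover from this have "t = 1 - s" "s \<in> {0..1}" by auto
    ultimately show "s *\<^sub>R x + t *\<^sub>R y \<in> {x. 0 < w x}"
      using conv[of s x y] by (auto simp: min_def split: if_splits)
  qed
  ultimately have "{a 0..b 0} \<subseteq> closure {x. w x > 0}"
    using ab[of 0] closed_segment_subset[of "a 0" "closure {x. w x > 0}" "b 0"]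
    by (simp add: closed_segment_eq_real_ivl)
  moreover have "closure {x. w x > 0} \<subseteq> {a 0..b 0}" using sub by (simp add: closure_minimal)
  ultimately have cl: "closure {x. w x > 0} = {a 0..b 0}" by blast
  have "open {x. w x < c}" for c
  proof -
    consider "c \<le> 0" | "c > 1" | "0 < c" "c \<le> 1" by linarith
    then show ?thesis
    proof cases
      case 1 then have "{x. w x < c} = {}" using order_trans[OF _ w0] by (auto simp: not_less)
      then show ?thesis by (metis open_empty)
    next
      case 2 then have "{x. w x < c} = UNIV" using w1 le_less_trans by blast
      then show ?thesis by (metis open_UNIV)
    next
      case 3
      have "x \<in> {x. w x < c} \<longleftrightarrow> x \<in> - {a c..b c}" for x using ge[OF 3, of x] by (simp add: not_le[symmetric])
      then have "{x. w x < c} = - {a c..b c}" by blast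
      then show ?thesis by (metis closed_atLeastAtMost open_Compl)
    qed
  qed
  moreover have "w (a 1) = 1" using ge[of 1 "a 1"] le w1[of "a 1"] by auto
  ultimately have "is_fuzzy_number w"
    unfolding is_fuzzy_number_def using w0 w1 conv cl by auto
  then have mw: "membership (Abs_fuzzy w) = w" by (simp add: Abs_fuzzy_inverse)
  have "level (Abs_fuzzy w) \<gamma> = {a \<gamma>..b \<gamma>}" if "0 \<le> \<gamma>" "\<gamma> \<le> 1" for \<gamma>
    using that cl ge[of \<gamma>] by (auto simp: level_def mw)
  then have "\<forall>\<gamma>\<in>{0..1}. lower (Abs_fuzzy w) \<gamma> = a \<gamma> \<and> upper (Abs_fuzzy w) \<gamma> = b \<gamma>"
    using ab by (simp add: lower_def upper_def)
  then show "\<exists>w. \<forall>\<gamma>\<in>{0..1}. lower w \<gamma> = a \<gamma> \<and> upper w \<gamma> = b \<gamma>" by blast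
next
  fix v w
  assume "\<forall>\<gamma>\<in>{0..1}. lower v \<gamma> = a \<gamma> \<and> upper v \<gamma> = b \<gamma>" "\<forall>\<gamma>\<in>{0..1}. lower w \<gamma> = a \<gamma> \<and> upper w \<gamma> = b \<gamma>"
  then show "v = w" by (intro fuzzy_eqI) auto
qed

instantiation fuzzy :: plus
begin

definition plus_fuzzy :: "fuzzy \<Rightarrow> fuzzy \<Rightarrow> fuzzy" where
  "u + v = (THE w. \<forall>\<gamma>\<in>{0..1}.
     lower w \<gamma> = lower u \<gamma> + lower v \<gamma> \<and> upper w \<gamma> = upper u \<gamma> + upper v \<gamma>)"

instance ..

end

lemma plus_fuzzy_ex1:
  "\<exists>!w. \<forall>\<gamma>\<in>{0..1}. lower w \<gamma> = lower u \<gamma> + lower v \<gamma> \<and> upper w \<gamma> = upper u \<gamma> + upper v \<gamma>"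
  by (rule fuzzy_exists)
    (auto intro!: add_mono lower_mono upper_antimono level_eq tendsto_add
      lower_tendsto_left upper_tendsto_left lower_tendsto_0 upper_tendsto_0)

lemma plus_fuzzy_levels:
  assumes "0 \<le> \<gamma>" "\<gamma> \<le> 1"
  shows "lower (u + v) \<gamma> = lower u \<gamma> + lower v \<gamma>" "upper (u + v) \<gamma> = upper u \<gamma> + upper v \<gamma>"
  using theI'[OF plus_fuzzy_ex1[of u v]] assms by (auto simp: plus_fuzzy_def)

text \<open>A negative scalar swaps the endpoints, hence \<open>min\<close> and \<open>max\<close>.\<close>

instantiation fuzzy :: scaleR
begin

definition scaleR_fuzzy :: "real \<Rightarrow> fuzzy \<Rightarrow> fuzzy" where
  "c *\<^sub>R u = (THE w. \<forall>\<gamma>\<in>{0..1}.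
     lower w \<gamma> = min (c * lower u \<gamma>) (c * upper u \<gamma>) \<and>
     upper w \<gamma> = max (c * lower u \<gamma>) (c * upper u \<gamma>))"

instance ..

end

lemma scaleR_fuzzy_ex1:
  "\<exists>!w. \<forall>\<gamma>\<in>{0..1}. lower w \<gamma> = min (c * lower u \<gamma>) (c * upper u \<gamma>) \<and>
     upper w \<gamma> = max (c * lower u \<gamma>) (c * upper u \<gamma>)"
proof (rule fuzzy_exists)
  fix \<gamma> \<mu> :: real assume l: "0 \<le> \<gamma>" "\<gamma> \<le> \<mu>" "\<mu> \<le> 1"
  have "lower u \<gamma> \<le> lower u \<mu>" "upper u \<mu> \<le> upper u \<gamma>" "lower u \<mu> \<le> upper u \<mu>"
    using l by (auto intro: lower_mono upper_antimono level_eq)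
  then have "c \<ge> 0 \<Longrightarrow> c * lower u \<gamma> \<le> c * lower u \<mu> \<and> c * lower u \<mu> \<le> c * upper u \<mu> \<and> c * upper u \<mu> \<le> c * upper u \<gamma>"
    "c \<le> 0 \<Longrightarrow> c * lower u \<gamma> \<ge> c * lower u \<mu> \<and> c * lower u \<mu> \<ge> c * upper u \<mu> \<and> c * upper u \<mu> \<ge> c * upper u \<gamma>"
    by (auto intro: mult_left_mono mult_left_mono_neg)
  then show "min (c * lower u \<gamma>) (c * upper u \<gamma>) \<le> min (c * lower u \<mu>) (c * upper u \<mu>) \<and>
    max (c * lower u \<mu>) (c * upper u \<mu>) \<le> max (c * lower u \<gamma>) (c * upper u \<gamma>)"
    by (cases "c \<ge> 0") (auto simp: min_def max_def)
qed (auto intro!: tendsto_min tendsto_max tendsto_mult_left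
      lower_tendsto_left upper_tendsto_left lower_tendsto_0 upper_tendsto_0)

lemma scaleR_fuzzy_levels:
  assumes "0 \<le> c" "0 \<le> \<gamma>" "\<gamma> \<le> 1"
  shows "lower (c *\<^sub>R u) \<gamma> = c * lower u \<gamma>" "upper (c *\<^sub>R u) \<gamma> = c * upper u \<gamma>"
  using theI'[OF scaleR_fuzzy_ex1[of c u]] assms mult_left_mono[OF level_eq(2)[OF assms(2,3)] assms(1), of u]
  by (auto simp: scaleR_fuzzy_def)

definition level_dist :: "fuzzy \<Rightarrow> fuzzy \<Rightarrow> real \<Rightarrow> real" where
  "level_dist u v \<gamma> = max \<bar>lower u \<gamma> - lower v \<gamma>\<bar> \<bar>upper u \<gamma> - upper v \<gamma>\<bar>"

lemma level_dist_bdd: "bdd_above (level_dist u v ` {0..1})"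
proof (rule bdd_aboveI2)
  fix \<gamma> :: real assume "\<gamma> \<in> {0..1}"
  then have l: "0 \<le> \<gamma>" "\<gamma> \<le> 1" by auto
  have "lower w 0 \<le> lower w \<gamma> \<and> lower w \<gamma> \<le> upper w \<gamma> \<and> upper w \<gamma> \<le> upper w 0" for w
    using l by (auto intro: lower_mono upper_antimono level_eq)
  from this[of u] this[of v]
  show "level_dist u v \<gamma> \<le> \<bar>lower u 0\<bar> + \<bar>upper u 0\<bar> + \<bar>lower v 0\<bar> + \<bar>upper v 0\<bar>"
    unfolding level_dist_def by linarith
qed

instantiation fuzzy :: metric_space
begin

definition dist_fuzzy :: "fuzzy \<Rightarrow> fuzzy \<Rightarrow> real" where
  "dist u v = (SUP \<gamma>\<in>{0..1}. max \<bar>lower u \<gamma> - lower v \<gamma>\<bar> \<bar>upper u \<gamma> - upper v \<gamma>\<bar>)"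

definition uniformity_fuzzy :: "(fuzzy \<times> fuzzy) filter" where
  "uniformity_fuzzy = (INF e\<in>{0 <..}. principal {(u, v). dist u v < e})"

definition open_fuzzy :: "fuzzy set \<Rightarrow> bool" where
  "open_fuzzy U \<longleftrightarrow> (\<forall>u\<in>U. eventually (\<lambda>(u', v). u' = u \<longrightarrow> v \<in> U) uniformity)"

instance
proof
  have d: "dist u v = (SUP \<gamma>\<in>{0..1}. level_dist u v \<gamma>)" for u v
    by (simp add: dist_fuzzy_def level_dist_def)
  have ub: "level_dist u v \<gamma> \<le> dist u v" if "0 \<le> \<gamma>" "\<gamma> \<le> 1" for u v \<gamma>
    unfolding d using that by (intro cSUP_upper level_dist_bdd) auto
  fix u v w :: fuzzy
  show "dist u v = 0 \<longleftrightarrow> u = v"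
  proof
    assume "dist u v = 0"
    then have "level_dist u v \<gamma> \<le> 0" if "0 \<le> \<gamma>" "\<gamma> \<le> 1" for \<gamma> using ub[OF that, of u v] by simp
    then show "u = v" by (intro fuzzy_eqI) (force simp: level_dist_def)+
  qed (simp add: dist_fuzzy_def)
  show "dist u v \<le> dist u w + dist v w"
    unfolding d[of u v]
  proof (rule cSUP_least)
    fix \<gamma> :: real assume "\<gamma> \<in> {0..1}"
    then have "level_dist u w \<gamma> \<le> dist u w" "level_dist v w \<gamma> \<le> dist v w" using ub by auto
    moreover have "level_dist u v \<gamma> \<le> level_dist u w \<gamma> + level_dist v w \<gamma>"
      unfolding level_dist_def
      using abs_triangle_ineq4[of "lower u \<gamma> - lower w \<gamma>" "lower v \<gamma> - lower w \<gamma>"]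
        abs_triangle_ineq4[of "upper u \<gamma> - upper w \<gamma>" "upper v \<gamma> - upper w \<gamma>"]
      by (intro max.boundedI) (auto elim!: order_trans intro!: add_mono)
    ultimately show "level_dist u v \<gamma> \<le> dist u w + dist v w" by simp
  qed simp
qed (simp_all add: uniformity_fuzzy_def open_fuzzy_def)

end

text \<open>\<open>SUP\<close> is unspecified on unbounded sets, so this is meaningful only where the distances are
  bounded, in particular for continuous functions on a compact set.\<close>

definition sup_dist :: "real set \<Rightarrow> (real \<Rightarrow> fuzzy) \<Rightarrow> (real \<Rightarrow> fuzzy) \<Rightarrow> real" where
  "sup_dist K f g = (SUP z\<in>K. dist (f z) (g z))"

section \<open>Recurrent fractal interpolation\<close>

text \<open>The \<open>i\<close>-th map sends the domain interval \<open>{x (s i)..x (e i)}\<close> onto \<open>{x (i - 1)..x i}\<close>,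
  for \<open>i\<close> from \<open>1\<close> to \<open>n\<close>.\<close>

definition lmap :: "(nat \<Rightarrow> real) \<Rightarrow> (nat \<Rightarrow> nat) \<Rightarrow> (nat \<Rightarrow> nat) \<Rightarrow> nat \<Rightarrow> real \<Rightarrow> real" where
  "lmap x s e i z = (x i - x (i - 1)) / (x (e i) - x (s i)) * (z - x (s i)) + x (i - 1)"

definition contained_count ::
    "nat \<Rightarrow> (nat \<Rightarrow> real) \<Rightarrow> (nat \<Rightarrow> nat) \<Rightarrow> (nat \<Rightarrow> nat) \<Rightarrow> nat \<Rightarrow> nat" where
  "contained_count n x s e k = card {i\<in>{1..n}. {x (k - 1)..x k} \<subseteq> {x (s i)..x (e i)}}"

definition transition_matrix ::
    "nat \<Rightarrow> (nat \<Rightarrow> real) \<Rightarrow> (nat \<Rightarrow> nat) \<Rightarrow> (nat \<Rightarrow> nat) \<Rightarrow> nat \<Rightarrow> nat \<Rightarrow> real" where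
  "transition_matrix n x s e k t =
     (if {x (k - 1)..x k} \<subseteq> {x (s t)..x (e t)} then 1 / real (contained_count n x s e k) else 0)"

text \<open>A matrix with rows and columns indexed by \<open>{1..n}\<close> is reducible if a simultaneous
  permutation of rows and columns makes it block upper triangular with two nonempty square
  diagonal blocks, the first one of size \<open>r\<close>.\<close>

definition irreducible_matrix :: "nat \<Rightarrow> (nat \<Rightarrow> nat \<Rightarrow> real) \<Rightarrow> bool" where
  "irreducible_matrix n M \<longleftrightarrow>
     \<not> (\<exists>\<pi> r. \<pi> permutes {1..n} \<and> 1 \<le> r \<and> r < n \<and>
          (\<forall>i\<in>{r+1..n}. \<forall>j\<in>{1..r}. M (\<pi> i) (\<pi> j) = 0))"

text \<open>The maps \<open>l i\<close> are a parameter since the perturbed function uses conjugates of the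
  affine maps instead of the affine maps themselves. Only the values of \<open>f\<close> on
  \<open>{x 0..x n}\<close>, of \<open>q i\<close> on \<open>{x (i - 1)..x i}\<close> and of \<open>l i\<close> on \<open>{x (s i)..x (e i)}\<close> matter.\<close>

definition is_RFIF ::
    "nat \<Rightarrow> (nat \<Rightarrow> real) \<Rightarrow> (nat \<Rightarrow> fuzzy) \<Rightarrow> (nat \<Rightarrow> nat) \<Rightarrow> (nat \<Rightarrow> nat) \<Rightarrow> (nat \<Rightarrow> real) \<Rightarrow>
     (nat \<Rightarrow> real \<Rightarrow> real) \<Rightarrow> (nat \<Rightarrow> real \<Rightarrow> fuzzy) \<Rightarrow> (real \<Rightarrow> fuzzy) \<Rightarrow> bool" where
  "is_RFIF n x u s e \<alpha> l q f \<longleftrightarrow>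
     continuous_on {x 0..x n} f \<and>
     (\<forall>i\<in>{0..n}. f (x i) = u i) \<and>
     (\<forall>i\<in>{1..n}. \<forall>z\<in>{x (i - 1)..x i}.
        f z = \<alpha> i *\<^sub>R f (inv_into {x (s i)..x (e i)} (l i) z) + q i z)"

end

theory Submission
  imports Defs
begin

text \<open>Transport the unperturbed function to the perturbed nodes. With
  \<open>\<rho> = R\<inverse>\<close>, the function \<open>f \<circ> \<rho>\<close> solves the same kind of functional equation as
  \<open>f'\<close>, with the \<^emph>\<open>same\<close> inner maps \<open>l' i = R \<circ> l i \<circ> \<rho>\<close> and vertical factors \<open>\<alpha> i\<close>,
  and with \<open>q i \<circ> \<rho>\<close> instead of \<open>q' i\<close>. The two equations are evaluated at the same
  points, so subtracting them gives, for the supremum distance \<open>S\<close> of \<open>f \<circ> \<rho>\<close> and \<open>f'\<close>,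
  the inequality \<open>S \<le> \<alpha> S + \<mu> M\<close>, where \<open>\<alpha>\<close> is the largest of the \<open>\<alpha> i\<close> and
  \<open>M = max dist (u k) (u' k)\<close>. Since \<open>S\<close> is finite, \<open>S \<le> \<mu> M / (1 - \<alpha>)\<close>. The estimate
  behind this is that \<open>a u \<oplus> p\<close> is \<open>a\<close>-Lipschitz in \<open>u\<close> and nonexpansive in \<open>p\<close> (\<open>dist_scaleR_plus_le\<close>).

  The remaining distance, from \<open>f\<close> to \<open>f \<circ> \<rho>\<close>, is controlled by the Hoelder condition: on
  each cell the displacement \<open>w - R w\<close> interpolates the node displacements
  \<open>x i - x' i\<close> affinely, so it never exceeds the largest of them
  (\<open>displacement_powr_le\<close>). Altogether the distance of \<open>f\<close> and \<open>f'\<close> is at most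
  \<open>H N + \<mu> M / (1 - \<alpha>)\<close> with \<open>N = max \<bar>x i - x' i\<bar> powr \<tau>\<close>, and
  \<open>1 \<le> (1 + \<alpha>) / (1 - \<alpha>)\<close> turns this into the stated form.\<close>

section \<open>The metric on fuzzy numbers\<close>

lemma dist_fuzzy_leI:
  assumes "\<And>\<gamma>. 0 \<le> \<gamma> \<Longrightarrow> \<gamma> \<le> 1 \<Longrightarrow> \<bar>lower u \<gamma> - lower v \<gamma>\<bar> \<le> c"
    and "\<And>\<gamma>. 0 \<le> \<gamma> \<Longrightarrow> \<gamma> \<le> 1 \<Longrightarrow> \<bar>upper u \<gamma> - upper v \<gamma>\<bar> \<le> c"
  shows "dist u v \<le> c"
  unfolding dist_fuzzy_def by (rule cSUP_least) (use assms in auto)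

lemma level_dist_le_dist:
  assumes "0 \<le> \<gamma>" "\<gamma> \<le> 1"
  shows "\<bar>lower u \<gamma> - lower v \<gamma>\<bar> \<le> dist u v" "\<bar>upper u \<gamma> - upper v \<gamma>\<bar> \<le> dist u v"
proof -
  have "level_dist u v \<gamma> \<le> (SUP \<gamma>\<in>{0..1}. level_dist u v \<gamma>)"
    using assms by (intro cSUP_upper level_dist_bdd) auto
  then have "level_dist u v \<gamma> \<le> dist u v"
    by (simp add: dist_fuzzy_def level_dist_def)
  then show "\<bar>lower u \<gamma> - lower v \<gamma>\<bar> \<le> dist u v" "\<bar>upper u \<gamma> - upper v \<gamma>\<bar> \<le> dist u v"
    by (simp_all add: level_dist_def)
qed

text \<open>Both operations act endpointwise for a nonnegative scalar, so this is the triangle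
  inequality for the real endpoints at every level.\<close>

lemma dist_scaleR_plus_le:
  fixes u v p q :: fuzzy
  assumes "0 \<le> a"
  shows "dist (a *\<^sub>R u + p) (a *\<^sub>R v + q) \<le> a * dist u v + dist p q"
proof -
  have endpoint: "\<bar>(a * b + c) - (a * b' + c')\<bar> \<le> a * dist u v + dist p q"
    if "\<bar>b - b'\<bar> \<le> dist u v" "\<bar>c - c'\<bar> \<le> dist p q" for b b' c c' :: real
  proof -
    have "\<bar>(a * b + c) - (a * b' + c')\<bar> = \<bar>a * (b - b') + (c - c')\<bar>"
      by (simp add: algebra_simps)
    also have "\<dots> \<le> a * \<bar>b - b'\<bar> + \<bar>c - c'\<bar>"
      using abs_triangle_ineq[of "a * (b - b')" "c - c'"] assms by (simp add: abs_mult)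
    also have "\<dots> \<le> a * dist u v + dist p q"
      using that assms by (intro add_mono mult_left_mono)
    finally show ?thesis .
  qed
  show ?thesis
    by (rule dist_fuzzy_leI)
      (simp_all add: plus_fuzzy_levels scaleR_fuzzy_levels assms endpoint level_dist_le_dist)
qed

lemma bdd_above_dist_image:
  fixes f g :: "'b \<Rightarrow> 'a::metric_space"
  assumes "bounded (f ` K)" "bounded (g ` K)"
  shows "bdd_above ((\<lambda>z. dist (f z) (g z)) ` K)"
proof -
  obtain c where c: "\<And>y z. y \<in> f ` K \<union> g ` K \<Longrightarrow> z \<in> f ` K \<union> g ` K \<Longrightarrow> dist y z \<le> c"
    using assms bounded_Un[of "f ` K" "g ` K"] bounded_two_points by metis
  show ?thesis by (rule bdd_aboveI2[of _ _ c]) (auto intro: c)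
qed

section \<open>Piecewise affine change of nodes\<close>

text \<open>The left end point is strict so that it can be inserted strictly between \<open>z\<close> and any
  smaller point outside the cell; strict monotonicity of \<open>R\<close> relies on this.\<close>

lemma between_consecutive_nodes:
  fixes x :: "nat \<Rightarrow> real"
  assumes "x 0 < z" "z \<le> x n"
  shows "\<exists>i\<in>{1..n}. x (i - 1) < z \<and> z \<le> x i"
proof -
  define i where "i = (LEAST j. z \<le> x j)"
  have i: "z \<le> x i" "i \<le> n" unfolding i_def using assms(2) by (auto intro: LeastI Least_le)
  have "i \<noteq> 0" using i(1) assms(1) by (cases "i = 0") auto
  then have "\<not> z \<le> x (i - 1)" unfolding i_def by (intro not_less_Least) simp
  then show ?thesis using i \<open>i \<noteq> 0\<close> by (intro bexI[of _ i]) auto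
qed

lemma affine_interpolation_weights:
  fixes a b c d z :: real
  assumes "a < b" "z \<in> {a..b}"
  obtains t where "t \<in> {0..1}" "z = (1 - t) * a + t * b"
    "c + (d - c) / (b - a) * (z - a) = (1 - t) * c + t * d"
proof
  show "(z - a) / (b - a) \<in> {0..1}" using assms by (auto simp: divide_simps)
  show "z = (1 - (z - a) / (b - a)) * a + (z - a) / (b - a) * b"
    using assms by (simp add: divide_simps) (simp add: algebra_simps)
  show "c + (d - c) / (b - a) * (z - a) = (1 - (z - a) / (b - a)) * c + (z - a) / (b - a) * d"
    using assms by (simp add: divide_simps) (simp add: algebra_simps)
qed

locale node_change =
  fixes n :: nat and x x' :: "nat \<Rightarrow> real" and R :: "real \<Rightarrow> real"
  assumes nodes: "strict_mono_on {0..n} x" and nodes': "strict_mono_on {0..n} x'"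
    and n_pos: "0 < n"
    and R_affine: "\<And>i z. i \<in> {1..n} \<Longrightarrow> z \<in> {x (i - 1)..x i} \<Longrightarrow>
      R z = x' (i - 1) + (x' i - x' (i - 1)) / (x i - x (i - 1)) * (z - x (i - 1))"
begin

lemma cell_less: "i \<in> {1..n} \<Longrightarrow> x (i - 1) < x i" "i \<in> {1..n} \<Longrightarrow> x' (i - 1) < x' i"
  by (auto intro!: strict_mono_onD[OF nodes] strict_mono_onD[OF nodes'])

lemma node_le: "i \<le> j \<Longrightarrow> j \<le> n \<Longrightarrow> x i \<le> x j" "i \<le> j \<Longrightarrow> j \<le> n \<Longrightarrow> x' i \<le> x' j"
  using strict_mono_onD[OF nodes, of i j] strict_mono_onD[OF nodes', of i j]
  by (cases "i = j"; force)+

lemma in_some_cell: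
  assumes "z \<in> {x 0..x n}"
  obtains i where "i \<in> {1..n}" "z \<in> {x (i - 1)..x i}"
proof (cases "z = x 0")
  case True
  then show thesis using that[of 1] cell_less(1)[of 1] n_pos by auto
next
  case False
  then have "x 0 < z" "z \<le> x n" using assms by auto
  then show thesis using that between_consecutive_nodes[of x z n] by force
qed

lemma cell_subset: "i \<in> {1..n} \<Longrightarrow> {x (i - 1)..x i} \<subseteq> {x 0..x n}"
  using node_le(1)[of 0 "i - 1"] node_le(1)[of i n] by auto

lemma R_cell_bounds:
  assumes "i \<in> {1..n}" "z \<in> {x (i - 1)..x i}"
  shows "x' (i - 1) \<le> R z" "R z \<le> x' i"
proof -
  obtain t where t: "t \<in> {0..1}" "R z = (1 - t) * x' (i - 1) + t * x' i"
    using affine_interpolation_weights[OF cell_less(1) assms(2)] R_affine[OF assms] assms(1)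
    by metis
  have "R z = x' (i - 1) + t * (x' i - x' (i - 1))"
    "R z = x' i - (1 - t) * (x' i - x' (i - 1))"
    using t(2) by (simp_all add: algebra_simps)
  moreover have "0 \<le> t * (x' i - x' (i - 1))" "0 \<le> (1 - t) * (x' i - x' (i - 1))"
    using t(1) cell_less(2)[OF assms(1)] by (auto intro!: mult_nonneg_nonneg)
  ultimately show "x' (i - 1) \<le> R z" "R z \<le> x' i" by linarith+
qed

lemma R_cell_strict_mono:
  assumes "i \<in> {1..n}" "y \<in> {x (i - 1)..x i}" "w \<in> {x (i - 1)..x i}" "y < w"
  shows "R y < R w"
  using assms cell_less[OF assms(1)]
  by (simp add: R_affine[OF assms(1)] divide_simps mult_strict_left_mono)

lemma R_strict_mono: "strict_mono_on {x 0..x n} R"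
proof (rule strict_mono_onI)
  fix y w assume y: "y \<in> {x 0..x n}" and w: "w \<in> {x 0..x n}" and "y < w"
  then obtain j where j: "j \<in> {1..n}" "x (j - 1) < w" "w \<le> x j"
    using between_consecutive_nodes[of x w n] by auto
  show "R y < R w"
  proof (cases "x (j - 1) \<le> y")
    case True
    then show ?thesis using R_cell_strict_mono[OF j(1)] j \<open>y < w\<close> by auto
  next
    case False
    obtain i where i: "i \<in> {1..n}" "y \<in> {x (i - 1)..x i}" using in_some_cell[OF y] .
    have "i \<le> j - 1"
    proof (rule ccontr)
      assume "\<not> i \<le> j - 1"
      then have "x (j - 1) \<le> x (i - 1)" using node_le(1)[of "j - 1" "i - 1"] i(1) by simp
      then show False using i(2) False by simp
    qed
    then have "R y \<le> x' (j - 1)"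
      using R_cell_bounds(2)[OF i] node_le(2)[of i "j - 1"] j(1) by (auto intro: order_trans)
    also have "x' (j - 1) = R (x (j - 1))"
      using R_affine[OF j(1), of "x (j - 1)"] cell_less(1)[OF j(1)] by simp
    also have "\<dots> < R w" using j by (intro R_cell_strict_mono[OF j(1)]) auto
    finally show ?thesis .
  qed
qed

lemma R_inj: "inj_on R {x 0..x n}"
  by (rule strict_mono_on_imp_inj_on[OF R_strict_mono])

lemma R_inv: "w \<in> {x 0..x n} \<Longrightarrow> inv_into {x 0..x n} R (R w) = w"
  by (rule inv_into_f_f[OF R_inj])

lemma R_node: "k \<le> n \<Longrightarrow> R (x k) = x' k"
  using R_affine[of k "x k"] R_affine[of 1 "x 0"] cell_less(1)[of 1] cell_less(1)[of k] n_pos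
  by (cases "k = 0") auto

lemma R_nodes_interval:
  assumes "a \<le> b" "b \<le> n" "w \<in> {x a..x b}"
  shows "R w \<in> {x' a..x' b}"
proof -
  have "mono_on {x 0..x n} R" by (rule strict_mono_on_imp_mono_on[OF R_strict_mono])
  moreover have "x a \<in> {x 0..x n}" "x b \<in> {x 0..x n}" "w \<in> {x 0..x n}"
    using assms node_le(1)[of 0 a] node_le(1)[of b n] by auto
  ultimately have "R (x a) \<le> R w" "R w \<le> R (x b)"
    using assms(3) by (auto elim!: monotone_onD)
  then show ?thesis using R_node[of a] R_node[of b] assms by simp
qed

lemma R_continuous: "continuous_on {x 0..x n} R"
proof -
  have "continuous_on (\<Union>i\<in>{1..n}. {x (i - 1)..x i}) R"
  proof (rule continuous_on_closed_Union)
    fix i assume i: "i \<in> {1..n}"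
    have "continuous_on {x (i - 1)..x i}
        (\<lambda>z. x' (i - 1) + (x' i - x' (i - 1)) / (x i - x (i - 1)) * (z - x (i - 1)))"
      by (intro continuous_intros)
    then show "continuous_on {x (i - 1)..x i} R"
      by (rule continuous_on_eq) (simp only: R_affine[OF i])
  qed auto
  moreover have "{x 0..x n} \<subseteq> (\<Union>i\<in>{1..n}. {x (i - 1)..x i})"
    using in_some_cell by blast
  ultimately show ?thesis by (rule continuous_on_subset)
qed

lemma R_image:
  assumes "a \<le> b" "b \<le> n"
  shows "R ` {x a..x b} = {x' a..x' b}"
proof
  show "R ` {x a..x b} \<subseteq> {x' a..x' b}" using R_nodes_interval[OF assms] by blast
  have "continuous_on {x a..x b} R"
    by (rule continuous_on_subset[OF R_continuous])
      (use assms node_le(1)[of 0 a] node_le(1)[of b n] in auto)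
  then have "\<exists>w\<ge>x a. w \<le> x b \<and> R w = z" if "z \<in> {x' a..x' b}" for z
    using that assms R_node[of a] R_node[of b] node_le(1)[of a b] by (intro IVT') auto
  then show "{x' a..x' b} \<subseteq> R ` {x a..x b}" by force
qed

text \<open>On a cell, \<open>w\<close> and \<open>R w\<close> are convex combinations of the old and the new end points
  with the same weights, so \<open>w - R w\<close> is that combination of the end point displacements.\<close>

lemma displacement_powr_le:
  assumes "w \<in> {x 0..x n}" "0 \<le> \<tau>"
  shows "\<bar>w - R w\<bar> powr \<tau> \<le> (MAX i\<in>{0..n}. \<bar>x i - x' i\<bar> powr \<tau>)"
proof -
  obtain i where i: "i \<in> {1..n}" "w \<in> {x (i - 1)..x i}" using in_some_cell[OF assms(1)] .
  define a b where "a = x (i - 1) - x' (i - 1)" and "b = x i - x' i"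
  obtain t where t: "t \<in> {0..1}" "w = (1 - t) * x (i - 1) + t * x i"
      "R w = (1 - t) * x' (i - 1) + t * x' i"
    using affine_interpolation_weights[OF cell_less(1) i(2)] R_affine[OF i] i(1) by metis
  have "\<bar>w - R w\<bar> = \<bar>(1 - t) * a + t * b\<bar>"
    unfolding a_def b_def by (subst t(3), subst t(2)) (simp add: algebra_simps)
  also have "\<dots> \<le> (1 - t) * \<bar>a\<bar> + t * \<bar>b\<bar>"
    using abs_triangle_ineq[of "(1 - t) * a" "t * b"] t(1) by (simp add: abs_mult)
  also have "\<dots> \<le> max \<bar>a\<bar> \<bar>b\<bar>"
    using t(1) by (intro convex_bound_le) auto
  finally have "\<bar>w - R w\<bar> powr \<tau> \<le> max \<bar>a\<bar> \<bar>b\<bar> powr \<tau>" using assms(2) by (intro powr_mono2) auto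
  moreover have "\<bar>x j - x' j\<bar> powr \<tau> \<le> (MAX i\<in>{0..n}. \<bar>x i - x' i\<bar> powr \<tau>)" if "j \<le> n" for j
    using that by (intro Max_ge) auto
  then have "\<bar>a\<bar> powr \<tau> \<le> (MAX i\<in>{0..n}. \<bar>x i - x' i\<bar> powr \<tau>)"
    "\<bar>b\<bar> powr \<tau> \<le> (MAX i\<in>{0..n}. \<bar>x i - x' i\<bar> powr \<tau>)"
    unfolding a_def b_def using i(1) by auto
  ultimately show ?thesis by (auto simp: max_def split: if_splits)
qed

end

section \<open>Inverses of the inner maps\<close>

text \<open>The functional equation at a point of a cell refers to \<open>inv_into\<close> of the affine map, which
  is a genuine preimage because that map is a bijection between the two intervals.\<close>

lemma lmap_bij_betw:
  assumes "x (i - 1) < x i" "x (s i) < x (e i)"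
  shows "bij_betw (lmap x s e i) {x (s i)..x (e i)} {x (i - 1)..x i}"
proof -
  have m: "0 < (x i - x (i - 1)) / (x (e i) - x (s i))" (is "0 < ?m") using assms by simp
  have "bij_betw (\<lambda>z. ?m * z + (x (i - 1) - ?m * x (s i))) {x (s i)..x (e i)} {x (i - 1)..x i}"
  proof (rule bij_betw_imageI)
    show "(\<lambda>z. ?m * z + (x (i - 1) - ?m * x (s i))) ` {x (s i)..x (e i)} = {x (i - 1)..x i}"
    proof -
      have "?m * x (s i) + (x (i - 1) - ?m * x (s i)) = x (i - 1)" by simp
      moreover have "?m * x (e i) + (x (i - 1) - ?m * x (s i)) = ?m * (x (e i) - x (s i)) + x (i - 1)"
        by (simp only: right_diff_distrib)
      then have "?m * x (e i) + (x (i - 1) - ?m * x (s i)) = x i" using assms(2) by simp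
      ultimately show ?thesis using assms(2) m by (simp only: image_affinity_atLeastAtMost) simp
    qed
  qed (use m in \<open>auto intro!: inj_onI\<close>)
  moreover have "lmap x s e i = (\<lambda>z. ?m * z + (x (i - 1) - ?m * x (s i)))"
    by (simp add: lmap_def fun_eq_iff algebra_simps diff_divide_distrib)
  ultimately show ?thesis by simp
qed

text \<open>A conjugate map is inverted by conjugating the inverse.\<close>

lemma inv_into_conjugate:
  assumes R: "inj_on R A" and l: "bij_betw l B C" and sub: "B \<subseteq> A" "C \<subseteq> A"
    and onto: "R ` B = B'" and w: "w \<in> C"
  shows "inv_into B' (R \<circ> l \<circ> inv_into A R) (R w) = R (inv_into B l w)"
proof (rule inv_into_f_eq)
  have v: "inv_into B l w \<in> B" "l (inv_into B l w) = w"
    using l w by (auto simp: bij_betw_def inv_into_into f_inv_into_f)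
  show "R (inv_into B l w) \<in> B'" using v(1) onto by auto
  show "(R \<circ> l \<circ> inv_into A R) (R (inv_into B l w)) = R w"
    using v sub R by (simp add: inv_into_f_f subset_iff)
  show "inj_on (R \<circ> l \<circ> inv_into A R) B'"
  proof (rule inj_onI)
    fix y z assume "y \<in> B'" "z \<in> B'" and eq: "(R \<circ> l \<circ> inv_into A R) y = (R \<circ> l \<circ> inv_into A R) z"
    then obtain y0 z0 where 0: "y0 \<in> B" "y = R y0" "z0 \<in> B" "z = R z0" using onto by auto
    then have "R (l y0) = R (l z0)" using eq sub R by (simp add: inv_into_f_f subset_iff)
    moreover have "l y0 \<in> C" "l z0 \<in> C" using 0 l by (auto simp: bij_betw_def)
    ultimately have "l y0 = l z0" using R sub(2) by (auto dest: inj_onD)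
    then show "y = z" using 0 l by (auto simp: bij_betw_def dest: inj_onD)
  qed
qed

section \<open>Stability under perturbation of the data\<close>

theorem theorem4:
  fixes n :: nat
    and x x' :: "nat \<Rightarrow> real"
    and u u' :: "nat \<Rightarrow> fuzzy"
    and s e :: "nat \<Rightarrow> nat"
    and \<alpha> :: "nat \<Rightarrow> real"
    and q q' :: "nat \<Rightarrow> real \<Rightarrow> fuzzy"
    and R :: "real \<Rightarrow> real"
    and l' :: "nat \<Rightarrow> real \<Rightarrow> real"
    and f f' :: "real \<Rightarrow> fuzzy"
    and H \<tau> \<mu> :: real
  assumes "n \<ge> 2"
    and "strict_mono_on {0..n} x"
    and "\<And>i. i \<in> {1..n} \<Longrightarrow> s i < e i \<and> e i \<le> n \<and> e i - s i \<ge> 2"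
    and "\<And>i. i \<in> {1..n} \<Longrightarrow> (x i - x (i - 1)) / (x (e i) - x (s i)) < 1"
    and "\<And>i. i \<in> {1..n} \<Longrightarrow> 0 \<le> \<alpha> i \<and> \<alpha> i < 1"
    and "\<And>i. i \<in> {1..n} \<Longrightarrow> \<exists>L. L-lipschitz_on {x (i - 1)..x i} (q i)"
    and "\<And>i. i \<in> {1..n} \<Longrightarrow> \<alpha> i *\<^sub>R u (s i) + q i (x (i - 1)) = u (i - 1)"
    and "\<And>i. i \<in> {1..n} \<Longrightarrow> \<alpha> i *\<^sub>R u (e i) + q i (x i) = u i"
    and "irreducible_matrix n (transition_matrix n x s e)"
    and "is_RFIF n x u s e \<alpha> (lmap x s e) q f"
    and "H \<ge> 0" and "0 < \<tau>" and "\<tau> \<le> 1"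
    and "\<And>y z. y \<in> {x 0..x n} \<Longrightarrow> z \<in> {x 0..x n} \<Longrightarrow>
           dist (f y) (f z) \<le> H * \<bar>y - z\<bar> powr \<tau>"
    and "strict_mono_on {0..n} x'" and "x' 0 = x 0" and "x' n = x n"
    and "\<And>i z. i \<in> {1..n} \<Longrightarrow> z \<in> {x (i - 1)..x i} \<Longrightarrow>
           R z = x' (i - 1) + (x' i - x' (i - 1)) / (x i - x (i - 1)) * (z - x (i - 1))"
    and "\<And>i. i \<in> {1..n} \<Longrightarrow> l' i = R \<circ> lmap x s e i \<circ> inv_into {x 0..x n} R"
    and "\<And>i. i \<in> {1..n} \<Longrightarrow> \<exists>L. L-lipschitz_on {x' (i - 1)..x' i} (q' i)"
    and "\<And>i. i \<in> {1..n} \<Longrightarrow> \<alpha> i *\<^sub>R u' (s i) + q' i (l' i (x' (s i))) = u' (i - 1)"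
    and "\<And>i. i \<in> {1..n} \<Longrightarrow> \<alpha> i *\<^sub>R u' (e i) + q' i (l' i (x' (e i))) = u' i"
    and "\<mu> \<ge> 0"
    and "\<And>i. i \<in> {1..n} \<Longrightarrow>
           sup_dist {x' (i - 1)..x' i} (q i \<circ> inv_into {x 0..x n} R) (q' i)
             \<le> \<mu> * (MAX k\<in>{0..n}. dist (u k) (u' k))"
    and "is_RFIF n x' u' s e \<alpha> l' q' f'"
  shows "sup_dist {x 0..x n} f f'
           \<le> ((1 + (MAX i\<in>{1..n}. \<alpha> i)) * H * (MAX i\<in>{0..n}. \<bar>x i - x' i\<bar> powr \<tau>)
               + \<mu> * (MAX i\<in>{0..n}. dist (u i) (u' i)))
             / (1 - (MAX i\<in>{1..n}. \<alpha> i))"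
proof -
  note n2 = assms(1) and idx = assms(3) and \<alpha>_range = assms(5) and q_lip = assms(6)
    and f_RFIF = assms(10) and H_nonneg = assms(11) and \<tau>_pos = assms(12) and Holder = assms(14)
    and ends = assms(16,17) and l'_eq = assms(19) and q'_lip = assms(20)
    and q_close = assms(24) and f'_RFIF = assms(25)
  define I where "I = {x 0..x n}"
  define \<alpha>\<^sub>m where "\<alpha>\<^sub>m = (MAX i\<in>{1..n}. \<alpha> i)"
  define N where "N = (MAX i\<in>{0..n}. \<bar>x i - x' i\<bar> powr \<tau>)"
  define M where "M = (MAX i\<in>{0..n}. dist (u i) (u' i))"
  interpret node_change n x x' R
    by unfold_locales (use n2 assms(2,15,18) in auto)

  have \<alpha>_le: "\<alpha> i \<le> \<alpha>\<^sub>m" if "i \<in> {1..n}" for i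
    unfolding \<alpha>\<^sub>m_def using that by (intro Max_ge) auto
  have \<alpha>\<^sub>m: "0 \<le> \<alpha>\<^sub>m" "\<alpha>\<^sub>m < 1"
  proof -
    show "0 \<le> \<alpha>\<^sub>m" using \<alpha>_le[of 1] \<alpha>_range[of 1] n2 by force
    show "\<alpha>\<^sub>m < 1" unfolding \<alpha>\<^sub>m_def using n2 \<alpha>_range by (subst Max_less_iff) auto
  qed
  have R_I: "R w \<in> I" if "w \<in> I" for w
    using R_nodes_interval[of 0 n w] that ends by (simp add: I_def)
  have I_ne: "I \<noteq> {}" using node_le(1)[of 0 n] by (simp add: I_def)

  have f_bdd: "bounded (f ` I)"
    using f_RFIF unfolding is_RFIF_def I_def
    by (auto intro: compact_imp_bounded compact_continuous_image)
  have f'_bdd: "bounded (f' ` I)"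
    using f'_RFIF ends unfolding is_RFIF_def I_def
    by (auto intro: compact_imp_bounded compact_continuous_image)

  \<comment> \<open>The distance of \<open>f \<circ> R\<inverse>\<close> and \<open>f'\<close>, with the points parametrised by \<open>I\<close> through \<open>R\<close>.
    Continuity on a compact interval makes it finite, so \<open>S\<close> bounds every single term.\<close>
  define S where "S = (SUP w\<in>I. dist (f w) (f' (R w)))"
  have S_bdd: "bdd_above ((\<lambda>w. dist (f w) (f' (R w))) ` I)"
    using f_bdd by (rule bdd_above_dist_image) (rule bounded_subset[OF f'_bdd], use R_I in auto)
  have S_upper: "dist (f w) (f' (R w)) \<le> S" if "w \<in> I" for w
    unfolding S_def using that S_bdd by (rule cSUP_upper)

  have q_dist: "dist (q i w) (q' i (R w)) \<le> \<mu> * M"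
    if i: "i \<in> {1..n}" and w: "w \<in> {x (i - 1)..x i}" for i w
  proof -
    define K where "K = {x' (i - 1)..x' i}"
    let ?\<rho> = "inv_into {x 0..x n} R"
    have \<rho>_cell: "?\<rho> z \<in> {x (i - 1)..x i}" if "z \<in> K" for z
    proof -
      have "z \<in> R ` {x (i - 1)..x i}" using that R_image[of "i - 1" i] i by (simp add: K_def)
      then obtain w where "w \<in> {x (i - 1)..x i}" "z = R w" by blast
      then show ?thesis using R_inv[of w] cell_subset[OF i] by auto
    qed
    \<comment> \<open>The supremum distance dominates the distance at a point only if the distances are
      bounded, which the Lipschitz conditions guarantee.\<close>
    have "bounded (q i ` {x (i - 1)..x i})" "bounded (q' i ` K)"
      using q_lip[OF i] q'_lip[OF i] unfolding K_def
      by (auto intro!: compact_imp_bounded compact_continuous_image intro: lipschitz_on_continuous_on)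
    then have "bdd_above ((\<lambda>z. dist ((q i \<circ> ?\<rho>) z) (q' i z)) ` K)"
      by (intro bdd_above_dist_image) (auto elim!: bounded_subset dest: \<rho>_cell)
    moreover have "R w \<in> K" using R_cell_bounds[OF i w] by (simp add: K_def)
    ultimately have "dist ((q i \<circ> ?\<rho>) (R w)) (q' i (R w)) \<le> sup_dist K (q i \<circ> ?\<rho>) (q' i)"
      unfolding sup_dist_def by (intro cSUP_upper)
    also have "\<dots> \<le> \<mu> * M" using q_close[OF i] by (simp add: K_def M_def)
    finally show ?thesis using R_inv[of w] cell_subset[OF i] w by auto
  qed

  \<comment> \<open>Subtract the functional equations of \<open>f\<close> at \<open>w\<close> and of \<open>f'\<close> at \<open>R w\<close>: their inner
    arguments \<open>v\<close> and \<open>R v\<close> correspond again.\<close>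
  have "S \<le> \<alpha>\<^sub>m * S + \<mu> * M"
  proof -
    have "dist (f w) (f' (R w)) \<le> \<alpha>\<^sub>m * S + \<mu> * M" if "w \<in> I" for w
    proof -
      from that obtain i where i: "i \<in> {1..n}" and w: "w \<in> {x (i - 1)..x i}"
        using in_some_cell unfolding I_def by blast
      have si: "s i < e i" "e i \<le> n" using idx[OF i] by auto
      define B where "B = {x (s i)..x (e i)}"
      define v where "v = inv_into B (lmap x s e i) w"
      have bij: "bij_betw (lmap x s e i) B {x (i - 1)..x i}"
        unfolding B_def using si by (intro lmap_bij_betw cell_less(1)[OF i] strict_mono_onD[OF nodes]) auto
      have B_sub: "B \<subseteq> {x 0..x n}"
        unfolding B_def using node_le(1)[of 0 "s i"] node_le(1)[of "e i" n] si by auto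
      have "v \<in> B" unfolding v_def using bij w by (auto simp: bij_betw_def inv_into_into)
      then have vI: "v \<in> I" using B_sub by (auto simp: I_def)
      have onto: "R ` B = {x' (s i)..x' (e i)}"
        unfolding B_def using si by (intro R_image) auto
      have v': "inv_into {x' (s i)..x' (e i)} (l' i) (R w) = R v"
        unfolding v_def l'_eq[OF i]
        by (rule inv_into_conjugate[OF R_inj bij B_sub cell_subset[OF i] onto w])
      have "f w = \<alpha> i *\<^sub>R f v + q i w"
        using f_RFIF i w unfolding is_RFIF_def v_def B_def by blast
      moreover have "f' (R w) = \<alpha> i *\<^sub>R f' (R v) + q' i (R w)"
        using f'_RFIF i R_cell_bounds[OF i w] unfolding is_RFIF_def v'[symmetric] by simp
      ultimately have "dist (f w) (f' (R w)) \<le> \<alpha> i * dist (f v) (f' (R v)) + dist (q i w) (q' i (R w))"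
        using dist_scaleR_plus_le \<alpha>_range[OF i] by simp
      also have "\<dots> \<le> \<alpha>\<^sub>m * S + \<mu> * M"
        using \<alpha>_le[OF i] S_upper[OF vI] \<alpha>\<^sub>m(1) by (intro add_mono mult_mono q_dist[OF i w]) auto
      finally show ?thesis .
    qed
    then have "(SUP w\<in>I. dist (f w) (f' (R w))) \<le> \<alpha>\<^sub>m * S + \<mu> * M"
      by (rule cSUP_least[OF I_ne])
    then show ?thesis by (simp add: S_def)
  qed
  then have S_le: "S \<le> \<mu> * M / (1 - \<alpha>\<^sub>m)" using \<alpha>\<^sub>m(2) by (simp add: field_simps)

  have "sup_dist I f f' \<le> H * N + S"
    unfolding sup_dist_def
  proof (rule cSUP_least[OF I_ne])
    fix z assume z: "z \<in> I"
    then obtain w where w: "w \<in> I" "z = R w"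
      using R_image[of 0 n] ends unfolding I_def by (metis imageE le0 le_refl)
    have "dist (f z) (f w) \<le> H * \<bar>z - w\<bar> powr \<tau>" using Holder z w(1) by (simp add: I_def)
    also have "\<dots> \<le> H * N"
      unfolding N_def using displacement_powr_le[of w \<tau>] w \<tau>_pos H_nonneg
      by (intro mult_left_mono) (auto simp: I_def abs_minus_commute)
    finally show "dist (f z) (f' z) \<le> H * N + S"
      using dist_triangle[of "f z" "f' z" "f w"] S_upper[OF w(1)] w(2) by simp
  qed
  also have "H * N + S \<le> (1 + \<alpha>\<^sub>m) * (H * N) / (1 - \<alpha>\<^sub>m) + \<mu> * M / (1 - \<alpha>\<^sub>m)"
  proof (rule add_mono[OF _ S_le])
    have "0 \<le> N" using displacement_powr_le[of "x 0" \<tau>] node_le(1)[of 0 n] \<tau>_pos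
      by (simp add: N_def order_trans[OF powr_ge_zero])
    then have "H * N * (1 - \<alpha>\<^sub>m) \<le> H * N * (1 + \<alpha>\<^sub>m)"
      using H_nonneg \<alpha>\<^sub>m(1) by (intro mult_left_mono) auto
    then show "H * N \<le> (1 + \<alpha>\<^sub>m) * (H * N) / (1 - \<alpha>\<^sub>m)"
      using \<alpha>\<^sub>m(2) by (simp add: pos_le_divide_eq mult.commute)
  qed
  also have "\<dots> = ((1 + \<alpha>\<^sub>m) * H * N + \<mu> * M) / (1 - \<alpha>\<^sub>m)"
    by (simp add: add_divide_distrib mult.assoc)
  finally show ?thesis unfolding I_def \<alpha>\<^sub>m_def N_def M_def .
qed

end
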